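(* Let $\mathcal{F}$ be a union-closed family of finite sets with $\emptyset\in\mathcal{F}$, and let $U\in J(\mathcal{F})$. Let $\mathcal{G}=\{V\in J(\mathcal{F}): V\cap U\neq\emptyset\}$. Suppose that (i) $|U|=2$; (ii) $\mathcal{G}$ is a graph, i.e. every member of $\mathcal{G}$ has one or two elements; (iii) there is a simple graph $\mathcal{G}'\subseteq J(\mathcal{F})$ (every member of $\mathcal{G}'$ has exactly two elements) such that for every $V\in\mathcal{G}$ with $|V|=2$ we have $V\in\mathcal{G}'$ and $d_{\mathcal{G}'}(V)\ge d_{\mathcal{G}'}(U)$. Then $(\mathcal{F},U)$ has the density property, i.e. $|\{W\in\mathcal{F}: W\supseteq U\}|\le \frac12|\mathcal{F}|$.
   Context: $J(\mathcal{F})$ denotes the set of union generators of $\mathcal{F}$: the nonempty $V\in\mathcal{F}$ that are not equal to the union of the members of $\mathcal{F}$ properly contained in $V$; every member of $\mathcal{F}$ is a union of members of $J(\mathcal{F})$. For a family $\mathcal{H}$ of sets (a graph) and a set $V$, the degree of $V$ in $\mathcal{H}$ is $d_{\mathcal{H}}(V)=|\{W\in\mathcal{H}\setminus\{V\}: W\cap V\neq\emptyset\}|$. *)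

theory Defs
  imports Main "HOL-Library.Extended_Nat"
begin

(* No finiteness of the family itself is assumed, so sizes of families are taken in enat:
   card would give the value 0 for an infinite family. *)
definition ecard :: "'a set \<Rightarrow> enat" where
  "ecard A = (if finite A then enat (card A) else \<infinity>)"

definition union_closed :: "'a set set \<Rightarrow> bool" where
  "union_closed F \<longleftrightarrow> (\<forall>A\<in>F. \<forall>B\<in>F. A \<union> B \<in> F)"

definition union_generators :: "'a set set \<Rightarrow> 'a set set" where
  "union_generators F = {V \<in> F. V \<noteq> {} \<and> V \<noteq> \<Union>{W \<in> F. W \<subset> V}}"

(* Singletons are loops. *)
definition is_graph :: "'a set set \<Rightarrow> bool" where
  "is_graph H \<longleftrightarrow> (\<forall>V\<in>H. card V = 1 \<or> card V = 2)"

definition is_simple_graph :: "'a set set \<Rightarrow> bool" where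
  "is_simple_graph H \<longleftrightarrow> (\<forall>V\<in>H. card V = 2)"

(* The degree of an edge (not of a vertex): the number of other members meeting it. *)
definition degree :: "'a set set \<Rightarrow> 'a set \<Rightarrow> enat" where
  "degree H V = ecard {W \<in> H - {V}. W \<inter> V \<noteq> {}}"

(* The inequality with 1/2 is multiplied out, since enat has no division. *)
definition density_property :: "'a set set \<Rightarrow> 'a set \<Rightarrow> bool" where
  "density_property F U \<longleftrightarrow> 2 * ecard {W \<in> F. U \<subseteq> W} \<le> ecard F"

end

theory Submission
  imports Defs Complex_Main
begin

text \<open>
  Let \<open>U = {a, b}\<close>, let \<open>K\<close> be the subfamily of members of \<open>F\<close> disjoint from \<open>U\<close>, and let \<open>A\<close>, \<open>B\<close>
  be the neighbours of \<open>a\<close>, \<open>b\<close> outside \<open>U\<close> (with \<open>m\<close>, \<open>n\<close> elements). The degree condition says that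
  every \<open>x \<in> A - B\<close> has at least \<open>n\<close> and every \<open>y \<in> B - A\<close> at least \<open>m\<close> neighbours in \<open>K\<close>. Call a point
  of \<open>T\<close> uncovered if no member of \<open>K\<close> inside \<open>T\<close> contains it. Deleting \<open>U\<close> from the members containing
  it gives sets with uncovered points in \<open>A \<union> B\<close>; conversely the sets with no uncovered point, those
  meeting \<open>A\<close> with uncovered points in \<open>A\<close> (add \<open>a\<close>), and likewise for \<open>B\<close>, yield members not
  containing \<open>U\<close>. The difference of the two counts is governed by the sets having uncovered points both in
  \<open>A - B\<close> and in \<open>B - A\<close>. These are rare: the neighbours of an uncovered \<open>x\<close> avoid \<open>T\<close>, and adding any
  set of them to \<open>T\<close> stays within the extension, so a factor \<open>2 ^ n\<close> (resp. \<open>2 ^ m\<close>) is gained.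
\<close>

section \<open>Uncovered points and extensions\<close>

definition uncovered :: "'a set set \<Rightarrow> 'a set \<Rightarrow> 'a set" where
  "uncovered K T = T - \<Union>{S \<in> K. S \<subseteq> T}"

text \<open>These are the sets \<open>\<Union>S \<union> C\<close> with
  \<open>S \<subseteq> K\<close> and \<open>C \<subseteq> E\<close>, so the singletons of
  \<open>E\<close> are adjoined to \<open>K\<close> as generators. In particular,
  \<open>extension K {}\<close> consists of the unions of subfamilies of \<open>K\<close>.\<close>

definition extension :: "'a set set \<Rightarrow> 'a set \<Rightarrow> 'a set set" where
  "extension K E = {T. uncovered K T \<subseteq> E}"

definition nbrs :: "'a set set \<Rightarrow> 'a \<Rightarrow> 'a set" where
  "nbrs K x = {z. z \<noteq> x \<and> {x, z} \<in> K}"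

lemma uncovered_subset: "uncovered K T \<subseteq> T"
  by (auto simp: uncovered_def)

lemma nbrs_disjoint_uncovered:
  assumes "x \<in> uncovered K T"
  shows "T \<inter> nbrs K x = {}"
proof -
  have "\<not> {x, z} \<subseteq> T" if "{x, z} \<in> K" for z
    using assms that unfolding uncovered_def by blast
  moreover have "x \<in> T" using assms by (simp add: uncovered_def)
  ultimately show ?thesis by (auto simp: nbrs_def)
qed

text \<open>Each added point \<open>w\<close> is covered by the edge \<open>{x, w}\<close>, and a
  point once covered stays covered when the set grows.\<close>

lemma uncovered_Un_nbrs:
  assumes "x \<in> T" and "N \<subseteq> nbrs K x"
  shows "uncovered K (T \<union> N) \<subseteq> uncovered K T"
proof
  fix w assume w: "w \<in> uncovered K (T \<union> N)"
  have "w \<notin> N"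
  proof
    assume "w \<in> N"
    then have "{x, w} \<in> K" "{x, w} \<subseteq> T \<union> N"
      using assms by (auto simp: nbrs_def)
    then show False using w unfolding uncovered_def by blast
  qed
  then show "w \<in> uncovered K T"
    using w unfolding uncovered_def by blast
qed

lemma uncovered_center:
  assumes "x \<in> T" and "N \<subseteq> nbrs K x" and "N \<noteq> {}"
  shows "x \<notin> uncovered K (T \<union> N)"
proof -
  obtain z where "z \<in> N" using assms(3) by auto
  then have "{x, z} \<in> K" "{x, z} \<subseteq> T \<union> N"
    using assms by (auto simp: nbrs_def)
  then show ?thesis unfolding uncovered_def by blast
qed

text \<open>No member of \<open>K\<close> inside \<open>T\<close> contains \<open>x\<close>, so the
  same members lie inside \<open>T - {x}\<close>.\<close>

lemma uncovered_remove:
  assumes "x \<in> uncovered K T"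
  shows "uncovered K (T - {x}) = uncovered K T - {x}"
proof -
  have "{S \<in> K. S \<subseteq> T - {x}} = {S \<in> K. S \<subseteq> T}"
    using assms by (auto simp: uncovered_def)
  then show ?thesis by (auto simp: uncovered_def)
qed

text \<open>A set is recovered from the members of \<open>K\<close> inside it together with its
  uncovered points.\<close>

lemma finite_extension:
  assumes "finite K" and "finite E"
  shows "finite (extension K E)"
proof (rule finite_subset)
  show "extension K E \<subseteq> (\<lambda>(S, C). \<Union>S \<union> C) ` (Pow K \<times> Pow E)"
  proof
    fix T assume "T \<in> extension K E"
    then have "T = (\<lambda>(S, C). \<Union>S \<union> C) ({S \<in> K. S \<subseteq> T}, uncovered K T)"
      and "({S \<in> K. S \<subseteq> T}, uncovered K T) \<in> Pow K \<times> Pow E"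
      by (auto simp: extension_def uncovered_def)
    then show "T \<in> (\<lambda>(S, C). \<Union>S \<union> C) ` (Pow K \<times> Pow E)" by blast
  qed
qed (use assms in auto)

lemma finite_nbrs:
  assumes "finite K" and "\<forall>S\<in>K. finite S"
  shows "finite (nbrs K x)"
proof (rule finite_subset)
  show "nbrs K x \<subseteq> \<Union>K" by (auto simp: nbrs_def)
  show "finite (\<Union>K)" using assms by blast
qed

section \<open>Injections that gain a power of two\<close>

lemma power2_mult_card_le:
  assumes "finite N" and "n \<le> card N" and "finite Y"
    and "inj_on f (D \<times> Pow N)" and "f ` (D \<times> Pow N) \<subseteq> Y"
  shows "card D * 2 ^ n \<le> card Y"
proof -
  have "card D * 2 ^ n \<le> card D * 2 ^ card N"
    using assms(2) by simp
  also have "\<dots> = card (D \<times> Pow N)"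
    using assms(1) by (simp add: card_cartesian_product card_Pow)
  also have "\<dots> \<le> card Y"
    using card_inj_on_le[OF assms(4,5,3)] .
  finally show ?thesis .
qed

text \<open>The map \<open>(T, N) \<mapsto> T \<union> N\<close> with
  \<open>N \<subseteq> nbrs K x\<close> is injective because \<open>T\<close> avoids
  \<open>nbrs K x\<close>. Its values meet \<open>A\<close> in \<open>x\<close>.\<close>

lemma card_uncovered_point_le:
  assumes "finite (extension K E)" and "finite (nbrs K x)"
    and "n \<le> card (nbrs K x)" and "x \<in> A"
  shows "card {T \<in> extension K E. x \<in> uncovered K T} * 2 ^ n
    \<le> card {T \<in> extension K E. T \<inter> A \<noteq> {}}"
proof (rule power2_mult_card_le[of "nbrs K x"])
  let ?D = "{T \<in> extension K E. x \<in> uncovered K T}"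
  have dis: "T \<inter> nbrs K x = {}" if "T \<in> ?D" for T
    using that nbrs_disjoint_uncovered by fastforce
  show "inj_on (\<lambda>(T, N). T \<union> N) (?D \<times> Pow (nbrs K x))"
  proof (rule inj_onI, clarify)
    fix T N T' N'
    assume *: "T \<in> extension K E" "x \<in> uncovered K T" "N \<subseteq> nbrs K x"
      "T' \<in> extension K E" "x \<in> uncovered K T'" "N' \<subseteq> nbrs K x" "T \<union> N = T' \<union> N'"
    then show "T = T' \<and> N = N'"
      using dis[of T] dis[of T'] by blast
  qed
  show "(\<lambda>(T, N). T \<union> N) ` (?D \<times> Pow (nbrs K x)) \<subseteq> {T \<in> extension K E. T \<inter> A \<noteq> {}}"
  proof clarify
    fix T N assume *: "T \<in> extension K E" "x \<in> uncovered K T" "N \<subseteq> nbrs K x"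
    have "x \<in> T" using * uncovered_subset by fastforce
    then show "T \<union> N \<in> extension K E \<and> (T \<union> N) \<inter> A \<noteq> {}"
      using uncovered_Un_nbrs[of x T N K] * assms(4) by (auto simp: extension_def)
  qed
qed (use assms in auto)

text \<open>The images must no longer have \<open>y\<close> uncovered. A nonempty \<open>N\<close>
  covers \<open>y\<close> through an edge; for \<open>N = {}\<close> the point \<open>y\<close> is
  deleted instead, which keeps a point of \<open>A\<close> because
  \<open>y \<notin> A\<close>.\<close>

lemma card_new_extension_le:
  assumes "finite (extension K C)" and "finite (nbrs K y)"
    and "m \<le> card (nbrs K y)" and "y \<notin> A"
  shows "card {T \<in> extension K (insert y C) - extension K C. T \<inter> A \<noteq> {}} * 2 ^ m
    \<le> card {T \<in> extension K C. T \<inter> A \<noteq> {}}"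
proof (rule power2_mult_card_le[of "nbrs K y"])
  let ?D = "{T \<in> extension K (insert y C) - extension K C. T \<inter> A \<noteq> {}}"
  let ?f = "\<lambda>(T, N). if N = {} then T - {y} else T \<union> N"
  have unc: "y \<in> uncovered K T" if "T \<in> ?D" for T
    using that by (auto simp: extension_def)
  have dis: "T \<inter> nbrs K y = {}" "y \<in> T" if "T \<in> ?D" for T
    using nbrs_disjoint_uncovered[OF unc[OF that]] unc[OF that] uncovered_subset[of K T] by auto
  show "inj_on ?f (?D \<times> Pow (nbrs K y))"
  proof (rule inj_onI, unfold mem_Times_iff, elim conjE)
    fix p q assume p: "fst p \<in> ?D" "snd p \<in> Pow (nbrs K y)"
      and q: "fst q \<in> ?D" "snd q \<in> Pow (nbrs K y)" and eq: "?f p = ?f q"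
    obtain T N T' N' where pq: "p = (T, N)" "q = (T', N')"
      by (cases p, cases q)
    have sub: "N \<subseteq> nbrs K y" "N' \<subseteq> nbrs K y" using p q pq by auto
    have d: "T \<inter> nbrs K y = {}" "y \<in> T" "T' \<inter> nbrs K y = {}" "y \<in> T'"
      using dis[of T] dis[of T'] p q pq by auto
    have e: "(if N = {} then T - {y} else T \<union> N) = (if N' = {} then T' - {y} else T' \<union> N')"
      using eq pq by simp
    \<comment> \<open>The image contains \<open>y\<close> exactly when \<open>N\<close> is
      nonempty.\<close>
    have "N = {} \<longleftrightarrow> N' = {}"
      using e d by (auto split: if_splits)
    then show "p = q"
    proof (cases "N = {}")
      case True
      then show ?thesis using e d pq \<open>N = {} \<longleftrightarrow> N' = {}\<close> by auto
    next
      case False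
      then have "T \<union> N = T' \<union> N'" using e \<open>N = {} \<longleftrightarrow> N' = {}\<close> by simp
      then have "T = T'" "N = N'" using d sub by blast+
      then show ?thesis using pq by simp
    qed
  qed
  show "?f ` (?D \<times> Pow (nbrs K y)) \<subseteq> {T \<in> extension K C. T \<inter> A \<noteq> {}}"
  proof (rule image_subsetI, unfold mem_Times_iff, elim conjE)
    fix p assume p: "fst p \<in> ?D" "snd p \<in> Pow (nbrs K y)"
    obtain T N where pq: "p = (T, N)" by (cases p)
    have T: "T \<in> ?D" and N: "N \<subseteq> nbrs K y" using p pq by auto
    have sub: "uncovered K T \<subseteq> insert y C" and meet: "T \<inter> A \<noteq> {}"
      using T by (auto simp: extension_def)
    show "?f p \<in> {T \<in> extension K C. T \<inter> A \<noteq> {}}"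
    proof (cases "N = {}")
      case True
      have "T - {y} \<in> extension K C"
        using sub uncovered_remove[OF unc[OF T]] by (auto simp: extension_def)
      moreover have "(T - {y}) \<inter> A \<noteq> {}" using meet assms(4) by auto
      ultimately show ?thesis using pq True by simp
    next
      case False
      have "uncovered K (T \<union> N) \<subseteq> C"
        using sub uncovered_Un_nbrs[OF dis(2)[OF T] N] uncovered_center[OF dis(2)[OF T] N False]
        by auto
      then show ?thesis using pq False meet by (auto simp: extension_def)
    qed
  qed
qed (use assms in auto)

lemma extension_mono: "C \<subseteq> E \<Longrightarrow> extension K C \<subseteq> extension K E"
  by (auto simp: extension_def)

text \<open>The points of \<open>B\<close> are adjoined one at a time; each adds at most the
  fraction \<open>1 / 2 ^ m\<close> of the sets already counted.\<close>

lemma card_extension_Un_le: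
  assumes "finite K" and "\<forall>S\<in>K. finite S" and "finite C" and "finite B"
    and "\<forall>y\<in>B. m \<le> card (nbrs K y)" and "B \<inter> A = {}"
  shows "real (card {T \<in> extension K (C \<union> B). T \<inter> A \<noteq> {}})
    \<le> (1 + 1 / 2 ^ m) ^ card B * real (card {T \<in> extension K C. T \<inter> A \<noteq> {}})"
  using assms(4,5,6)
proof (induction B rule: finite_induct)
  case empty
  then show ?case by simp
next
  case (insert y B)
  let ?X = "\<lambda>E. {T \<in> extension K E. T \<inter> A \<noteq> {}}"
  let ?D = "{T \<in> extension K (insert y (C \<union> B)) - extension K (C \<union> B). T \<inter> A \<noteq> {}}"
  have fin: "finite (extension K E)" if "finite E" for E
    using finite_extension that assms(1) by blast
  have "card ?D * 2 ^ m \<le> card (?X (C \<union> B))"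
    using insert.prems insert.hyps assms fin finite_nbrs[OF assms(1,2)]
    by (intro card_new_extension_le) auto
  from of_nat_mono[OF this, where 'a=real]
  have "real (card ?D) * 2 ^ m \<le> real (card (?X (C \<union> B)))" by simp
  then have D: "real (card ?D) \<le> 1 / 2 ^ m * real (card (?X (C \<union> B)))"
    by (simp add: field_simps)
  have "?X (C \<union> insert y B) = ?X (C \<union> B) \<union> ?D"
    using extension_mono[of "C \<union> B" "insert y (C \<union> B)" K] by auto
  then have "card (?X (C \<union> insert y B)) \<le> card (?X (C \<union> B)) + card ?D"
    by (simp only: card_Un_le)
  then have "real (card (?X (C \<union> insert y B))) \<le> real (card (?X (C \<union> B))) + real (card ?D)"
    by linarith
  also have "\<dots> \<le> (1 + 1 / 2 ^ m) * real (card (?X (C \<union> B)))"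
    using D by (simp add: algebra_simps)
  also have "\<dots> \<le> (1 + 1 / 2 ^ m) * ((1 + 1 / 2 ^ m) ^ card B * real (card (?X C)))"
    using insert.IH insert.prems by (intro mult_left_mono) auto
  also have "\<dots> = (1 + 1 / 2 ^ m) ^ card (insert y B) * real (card (?X C))"
    using insert.hyps by simp
  finally show ?case .
qed

text \<open>This is a union bound over the possible uncovered points in \<open>A\<close>.\<close>

lemma card_uncovered_set_le:
  assumes "finite K" and "\<forall>S\<in>K. finite S" and "finite E" and "finite A"
    and "\<forall>x\<in>A. n \<le> card (nbrs K x)"
  shows "card {T \<in> extension K E. uncovered K T \<inter> A \<noteq> {}} * 2 ^ n
    \<le> card A * card {T \<in> extension K E. T \<inter> A \<noteq> {}}"
proof -
  let ?D = "\<lambda>x. {T \<in> extension K E. x \<in> uncovered K T}"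
  have "{T \<in> extension K E. uncovered K T \<inter> A \<noteq> {}} = (\<Union>x\<in>A. ?D x)" by auto
  then have "card {T \<in> extension K E. uncovered K T \<inter> A \<noteq> {}} \<le> (\<Sum>x\<in>A. card (?D x))"
    using card_UN_le[OF assms(4)] by simp
  then have "card {T \<in> extension K E. uncovered K T \<inter> A \<noteq> {}} * 2 ^ n
    \<le> (\<Sum>x\<in>A. card (?D x) * 2 ^ n)"
    by (simp add: sum_distrib_right[symmetric])
  also have "\<dots> \<le> (\<Sum>x\<in>A. card {T \<in> extension K E. T \<inter> A \<noteq> {}})"
    using assms finite_extension[OF assms(1,3)] finite_nbrs[OF assms(1,2)]
    by (intro sum_mono card_uncovered_point_le) auto
  finally show ?thesis by simp
qed

section \<open>Sets with uncovered points in both \<open>A - B\<close> and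
  \<open>B - A\<close>\<close>

definition doubly_uncovered :: "'a set set \<Rightarrow> 'a set \<Rightarrow> 'a set \<Rightarrow> 'a set set" where
  "doubly_uncovered K A B = extension K (A \<union> B) - extension K A - extension K B"

text \<open>Three estimates are chained. An uncovered point of \<open>A - B\<close> gains
  \<open>2 ^ n\<close>; passing from \<open>A \<union> B\<close> to \<open>A\<close> costs a factor
  \<open>1 + 1 / 2 ^ m\<close> per point of \<open>B - A\<close>; passing from \<open>A\<close> to
  \<open>A \<inter> B\<close> costs \<open>2 ^ n / (2 ^ n - card (A - B))\<close>, where the
  denominator is positive by the last hypothesis.\<close>

lemma card_doubly_uncovered_le:
  fixes A B :: "'a set"
  assumes "finite K" and "\<forall>S\<in>K. finite S" and "finite A" and "finite B"
    and A: "\<forall>x\<in>A - B. n \<le> card (nbrs K x)" and B: "\<forall>y\<in>B - A. m \<le> card (nbrs K y)"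
    and n: "card (A - B) < 2 ^ n"
  shows "(2 ^ n - real (card (A - B))) * real (card (doubly_uncovered K A B))
    \<le> real (card (A - B)) * (1 + 1 / 2 ^ m) ^ card (B - A)
      * real (card {T \<in> extension K (A \<inter> B). T \<inter> (A - B) \<noteq> {}})"
proof -
  let ?X = "\<lambda>E. {T \<in> extension K E. T \<inter> (A - B) \<noteq> {}}"
  let ?D = "\<lambda>E. {T \<in> extension K E. uncovered K T \<inter> (A - B) \<noteq> {}}"
  define k v bad where "k = real (card (A - B))" and "v = (1 + 1 / 2 ^ m :: real) ^ card (B - A)"
    and "bad = real (card (doubly_uncovered K A B))"
  define LAB LA p where "LAB = real (card (?X (A \<union> B)))" and "LA = real (card (?X A))"
    and "p = real (card (?X (A \<inter> B)))"
  have fin: "finite (extension K E)" if "finite E" for E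
    using finite_extension that assms(1) by blast
  have D: "real (card (?D E)) * 2 ^ n \<le> k * real (card (?X E))" if "finite E" for E
  proof -
    have "card (?D E) * 2 ^ n \<le> card (A - B) * card (?X E)"
      using card_uncovered_set_le[OF assms(1,2) that _ A] assms(3) by simp
    from of_nat_mono[OF this, where 'a=real] show ?thesis by (simp add: k_def)
  qed
  have "doubly_uncovered K A B \<subseteq> ?D (A \<union> B)"
    by (auto simp: doubly_uncovered_def extension_def)
  then have "bad \<le> real (card (?D (A \<union> B)))"
    unfolding bad_def using fin assms(3,4) by (simp add: card_mono)
  then have "bad * 2 ^ n \<le> real (card (?D (A \<union> B))) * 2 ^ n" by simp
  also have "\<dots> \<le> k * LAB"
    unfolding LAB_def using D assms(3,4) by simp
  also have "\<dots> \<le> k * (v * LA)"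
  proof (rule mult_left_mono)
    have "A \<union> B = A \<union> (B - A)" by auto
    then show "LAB \<le> v * LA"
      using card_extension_Un_le[OF assms(1,2,3) _ B, of "A - B"] assms(4)
      unfolding LAB_def LA_def v_def by auto
  qed (simp add: k_def)
  finally have 1: "bad * 2 ^ n \<le> k * (v * LA)" .
  \<comment> \<open>A set of \<open>extension K A\<close> has uncovered points only in
    \<open>A \<inter> B\<close>, or has one in \<open>A - B\<close>. The latter sets number at most
    \<open>k / 2 ^ n * LA\<close>; moving this term to the left leaves the factor
    \<open>2 ^ n - k\<close>.\<close>
  have "?X A \<subseteq> ?X (A \<inter> B) \<union> ?D A"
    by (auto simp: extension_def)
  then have "card (?X A) \<le> card (?X (A \<inter> B) \<union> ?D A)"
    using fin assms(3) by (intro card_mono) auto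
  also have "\<dots> \<le> card (?X (A \<inter> B)) + card (?D A)" by (rule card_Un_le)
  finally have "LA \<le> p + real (card (?D A))"
    unfolding LA_def p_def by linarith
  then have "LA * 2 ^ n \<le> p * 2 ^ n + real (card (?D A)) * 2 ^ n"
    by (simp add: distrib_right[symmetric])
  then have 2: "(2 ^ n - k) * LA \<le> 2 ^ n * p"
    using D[OF assms(3)] unfolding LA_def by (simp add: algebra_simps)
  have k: "k < 2 ^ n" "0 \<le> k" "0 \<le> v"
    using of_nat_less_iff[of "card (A - B)" "2 ^ n", where 'a=real] n by (simp_all add: k_def v_def)
  have "2 ^ n * ((2 ^ n - k) * bad) = (2 ^ n - k) * (bad * 2 ^ n)" by simp
  also have "\<dots> \<le> (2 ^ n - k) * (k * (v * LA))"
    using 1 k by (intro mult_left_mono) auto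
  also have "\<dots> = (k * v) * ((2 ^ n - k) * LA)" by simp
  also have "\<dots> \<le> (k * v) * (2 ^ n * p)"
    using 2 k by (intro mult_left_mono) auto
  also have "\<dots> = 2 ^ n * (k * v * p)" by simp
  finally have "(2 ^ n - k) * bad \<le> k * v * p" by simp
  then show ?thesis unfolding k_def v_def bad_def p_def .
qed

section \<open>Numerical estimates\<close>

lemma two_power_ge_aux: "4 \<le> n \<Longrightarrow> real n * ((5/4) ^ n + 1) \<le> 2 ^ n"
proof (induction n rule: nat_induct_at_least)
  case base
  show ?case by (simp add: power_divide)
next
  case (Suc n)
  let ?q = "(5/4 :: real) ^ n"
  have "real (Suc n) * ((5/4) ^ Suc n + 1) = (real n + 1) * (5/4 * ?q + 1)" by simp
  \<comment> \<open>Since \<open>4 \<le> n\<close>, \<open>n + 1\<close> is at most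
    \<open>5/4 * n\<close>. The left side thus grows by at most \<open>25/16\<close>, which is below
    the factor 2 gained on the right.\<close>
  also have "\<dots> \<le> (5/4 * real n) * (5/4 * ?q + 5/4)"
    using Suc.hyps by (intro mult_mono) auto
  also have "\<dots> = 25/16 * (real n * (?q + 1))" by (simp add: algebra_simps)
  also have "\<dots> \<le> 2 * (real n * (?q + 1))"
    by (intro mult_right_mono) auto
  also have "\<dots> \<le> 2 ^ Suc n" using Suc.IH by simp
  finally show ?case .
qed

text \<open>The last hypothesis excludes exactly \<open>m = n = 1\<close> and
  \<open>m = n = 2\<close>, where the inequality fails: the left side is \<open>5/2\<close> against
  2 and \<open>41/8\<close> against 4.\<close>

lemma two_power_ge:
  assumes "1 \<le> m" and "m \<le> n" and "m < n \<or> 3 \<le> n"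
  shows "real m * ((1 + 1 / 2 ^ m) ^ n + 1) \<le> 2 ^ n"
proof (cases "m = 1")
  case True
  have "2 \<le> n" using assms True by auto
  then have "(3/2) ^ n + 1 \<le> (2::real) ^ n"
  proof (induction n rule: nat_induct_at_least)
    case base
    show ?case by (simp add: power_divide)
  next
    case (Suc n)
    have "(0::real) \<le> (3/2) ^ n" by simp
    moreover have "(3/2) ^ Suc n = 3/2 * (3/2 :: real) ^ n" "2 ^ Suc n = 2 * (2::real) ^ n"
      by simp_all
    ultimately show ?case using Suc.IH by linarith
  qed
  then show ?thesis using True by simp
next
  case False
  show ?thesis
  proof (cases "n = 3")
    case True
    then have "m = 2 \<or> m = 3" using assms False by auto
    then show ?thesis using True by (auto simp: power_divide)
  next
    case n: False
    then have n4: "4 \<le> n" using assms False by auto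
    have "(2::real) ^ 2 \<le> 2 ^ m" using assms False by (intro power_increasing) auto
    then have "1 + 1 / 2 ^ m \<le> (5/4::real)" by (simp add: field_simps)
    then have "(1 + 1 / 2 ^ m :: real) ^ n \<le> (5/4) ^ n" by (intro power_mono) auto
    then have "real m * ((1 + 1 / 2 ^ m) ^ n + 1) \<le> real n * ((5/4) ^ n + 1)"
      using assms by (intro mult_mono) auto
    also have "\<dots> \<le> 2 ^ n" using two_power_ge_aux[OF n4] .
    finally show ?thesis .
  qed
qed

section \<open>Doubly uncovered sets under the degree condition\<close>

lemma doubly_uncovered_commute: "doubly_uncovered K A B = doubly_uncovered K B A"
  by (auto simp: doubly_uncovered_def Un_commute)

text \<open>The right side is exactly the slack left by inclusion and exclusion in the comparison of
  the extensions. The first summand alone suffices unless \<open>A\<close> and \<open>B\<close> are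
  disjoint, of equal size 1 or 2.\<close>

lemma card_doubly_uncovered_le_meeting:
  fixes A B :: "'a set"
  assumes fin: "finite K" "\<forall>S\<in>K. finite S" "finite A" "finite B"
    and A: "\<forall>x\<in>A - B. card B \<le> card (nbrs K x)"
    and B: "\<forall>y\<in>B - A. card A \<le> card (nbrs K y)"
    and le: "card A \<le> card B"
  shows "card (doubly_uncovered K A B)
    \<le> card {T \<in> extension K (A \<inter> B). T \<inter> A \<noteq> {}} + card {T \<in> extension K {}. T \<inter> B \<noteq> {}}"
proof -
  define m n k l where "m = card A" and "n = card B" and "k = card (A - B)" and "l = card (B - A)"
  define p where "p = card {T \<in> extension K (A \<inter> B). T \<inter> (A - B) \<noteq> {}}"
  define bad where "bad = card (doubly_uncovered K A B)"
  have kl: "m = k + card (A \<inter> B)" "n = l + card (A \<inter> B)"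
    unfolding m_def n_def k_def l_def using fin(3,4)
    by (metis card_Diff_subset_Int card_mono finite_Int inf_le1 le_add_diff_inverse2,
        metis card_Diff_subset_Int card_mono finite_Int inf_commute inf_le1 le_add_diff_inverse2)
  have mn: "m \<le> n" using le by (simp add: m_def n_def)
  have "k \<le> n" using kl(1) mn by linarith
  then have k2: "k < 2 ^ n" using less_exp[of n] by linarith
  then have k2': "real k < 2 ^ n"
    by (metis of_nat_less_iff of_nat_numeral of_nat_power)
  have main: "(2 ^ n - real k) * real bad \<le> real k * (1 + 1 / 2 ^ m) ^ l * real p"
    unfolding m_def n_def k_def l_def p_def bad_def
    using card_doubly_uncovered_le[OF fin A B] k2 by (simp add: k_def n_def)
  have pA: "p \<le> card {T \<in> extension K (A \<inter> B). T \<inter> A \<noteq> {}}"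
    unfolding p_def using finite_extension[of K "A \<inter> B"] fin by (intro card_mono) auto
  \<comment> \<open>The condition says that the constant in \<open>main\<close>, after division by
    \<open>2 ^ n - k\<close>, is at most 1.\<close>
  have good: "bad \<le> p" if "real k * ((1 + 1 / 2 ^ m) ^ l + 1) \<le> 2 ^ n"
  proof -
    have "real k * (1 + 1 / 2 ^ m) ^ l \<le> 2 ^ n - real k"
      using that by (simp add: algebra_simps)
    then have "real k * (1 + 1 / 2 ^ m) ^ l * real p \<le> (2 ^ n - real k) * real p"
      by (intro mult_right_mono) auto
    then have "(2 ^ n - real k) * real bad \<le> (2 ^ n - real k) * real p"
      using main by linarith
    then show ?thesis using k2' by simp
  qed
  \<comment> \<open>Only \<open>m = n \<le> 2\<close> escapes \<open>two_power_ge\<close>. If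
    \<open>A\<close> and \<open>B\<close> then share a point, \<open>k = l = 1\<close> and
    \<open>m = 2\<close>, so the condition of \<open>good\<close> reads
    \<open>9/4 \<le> 4\<close>.\<close>
  consider "k = 0" | "1 \<le> k" "m < n \<or> 3 \<le> n" | "1 \<le> k" "m = n" "n \<le> 2" "A \<inter> B \<noteq> {}"
    | "1 \<le> k" "m = n" "n \<le> 2" "A \<inter> B = {}"
    using mn by linarith
  then show ?thesis
  proof cases
    case 1
    then show ?thesis using good pA by (simp add: bad_def)
  next
    case 2
    have "1 \<le> m" using 2 kl by simp
    have "(1 + 1 / 2 ^ m :: real) ^ l \<le> (1 + 1 / 2 ^ m) ^ n"
      using kl by (intro power_increasing) auto
    then have "real k * ((1 + 1 / 2 ^ m) ^ l + 1) \<le> real m * ((1 + 1 / 2 ^ m) ^ n + 1)"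
      using kl by (intro mult_mono) auto
    also have "\<dots> \<le> 2 ^ n" using two_power_ge[OF \<open>1 \<le> m\<close> mn] 2 by simp
    finally show ?thesis using good pA by (simp add: bad_def)
  next
    case 3
    have "card (A \<inter> B) > 0" using 3 fin by (simp add: card_gt_0_iff)
    then have "k = 1" "l = 1" "m = 2" "n = 2" using 3 kl by auto
    then show ?thesis using good pA by (simp add: bad_def)
  next
    case 4
    \<comment> \<open>For \<open>m = n \<le> 2\<close> the constant lies between 1 and 2, so the bounds for \<open>A\<close> and \<open>B\<close> are averaged.\<close>
    then have kn: "k = n" "l = n" using kl by auto
    define q where "q = card {T \<in> extension K (B \<inter> A). T \<inter> (B - A) \<noteq> {}}"
    have main': "(2 ^ n - real n) * real bad \<le> real n * (1 + 1 / 2 ^ n) ^ n * real q"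
      using card_doubly_uncovered_le[OF fin(1,2,4,3) B A] k2 4 kn
      unfolding q_def bad_def doubly_uncovered_commute[of K A B]
      by (simp add: k_def l_def n_def m_def)
    have n12: "n = 1 \<or> n = 2" using 4 kn by auto
    have "bad \<le> 2 * p" "bad \<le> 2 * q"
      using n12 main main' kn 4 by (auto simp: power_divide)
    moreover have "p = card {T \<in> extension K (A \<inter> B). T \<inter> A \<noteq> {}}"
      "q = card {T \<in> extension K {}. T \<inter> B \<noteq> {}}"
      unfolding p_def q_def using 4 by (auto simp: Diff_triv Int_commute)
    ultimately show ?thesis by (simp add: bad_def)
  qed
qed

section \<open>Comparing the sizes of the extensions\<close>

lemma card_filter_split:
  "finite X \<Longrightarrow> card X = card {T \<in> X. P T} + card {T \<in> X. \<not> P T}"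
  by (subst card_Un_disjoint[symmetric]) (auto intro: arg_cong[where f=card])

text \<open>A set that misses \<open>A\<close> has no uncovered point in \<open>E\<close>, so the
  sets missing \<open>A\<close> are the same for every \<open>E \<subseteq> A\<close>.\<close>

lemma card_extension_meeting:
  assumes "finite K" and "finite E" and "E \<subseteq> A"
  shows "card (extension K E)
    = card {T \<in> extension K E. T \<inter> A \<noteq> {}} + card {T \<in> extension K {}. T \<inter> A = {}}"
proof -
  have "{T \<in> extension K E. \<not> T \<inter> A \<noteq> {}} = {T \<in> extension K {}. T \<inter> A = {}}"
    using assms(3) uncovered_subset[of K] by (fastforce simp: extension_def)
  then show ?thesis
    using card_filter_split[OF finite_extension[OF assms(1,2)], of "\<lambda>T. T \<inter> A \<noteq> {}"] by simp
qed

text \<open>Inclusion and exclusion applies because \<open>extension K A\<close> and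
  \<open>extension K B\<close> intersect in \<open>extension K (A \<inter> B)\<close>. The sets
  missing \<open>A\<close> cancel between the extensions by \<open>A\<close> and
  \<open>A \<inter> B\<close>, those missing \<open>B\<close> between the extensions by
  \<open>B\<close> and \<open>{}\<close>.\<close>

lemma card_extension_Un_le_sum_if_card_le:
  fixes A B :: "'a set"
  assumes fin: "finite K" "\<forall>S\<in>K. finite S" "finite A" "finite B"
    and A: "\<forall>x\<in>A - B. card B \<le> card (nbrs K x)"
    and B: "\<forall>y\<in>B - A. card A \<le> card (nbrs K y)"
    and le: "card A \<le> card B"
  shows "card (extension K (A \<union> B)) \<le> card (extension K {})
    + card {T \<in> extension K A. T \<inter> A \<noteq> {}} + card {T \<in> extension K B. T \<inter> B \<noteq> {}}"
proof -
  let ?M = "\<lambda>E A. card {T \<in> extension K E. T \<inter> A \<noteq> {}}"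
  have fe: "finite (extension K A)" "finite (extension K B)"
    using finite_extension fin by blast+
  have bad: "card (doubly_uncovered K A B) \<le> ?M (A \<inter> B) A + ?M {} B"
    using card_doubly_uncovered_le_meeting[OF fin A B le] .
  have "extension K (A \<union> B) = doubly_uncovered K A B \<union> (extension K A \<union> extension K B)"
    using extension_mono[of A "A \<union> B" K] extension_mono[of B "A \<union> B" K]
    by (auto simp: doubly_uncovered_def)
  then have "card (extension K (A \<union> B))
    \<le> card (doubly_uncovered K A B) + card (extension K A \<union> extension K B)"
    by (simp add: card_Un_le)
  moreover have "extension K A \<inter> extension K B = extension K (A \<inter> B)"
    by (auto simp: extension_def)
  then have "card (extension K A) + card (extension K B)
    = card (extension K A \<union> extension K B) + card (extension K (A \<inter> B))"
    using card_Un_Int[OF fe] by simp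
  moreover have "card (extension K A) = ?M A A + card {T \<in> extension K {}. T \<inter> A = {}}"
    "card (extension K B) = ?M B B + card {T \<in> extension K {}. T \<inter> B = {}}"
    "card (extension K (A \<inter> B)) = ?M (A \<inter> B) A + card {T \<in> extension K {}. T \<inter> A = {}}"
    "card (extension K {}) = ?M {} B + card {T \<in> extension K {}. T \<inter> B = {}}"
    by (rule card_extension_meeting; use fin in auto)+
  ultimately show ?thesis
    using bad by linarith
qed

lemma card_extension_Un_le_sum:
  fixes A B :: "'a set"
  assumes "finite K" "\<forall>S\<in>K. finite S" "finite A" "finite B"
    and "\<forall>x\<in>A - B. card B \<le> card (nbrs K x)"
    and "\<forall>y\<in>B - A. card A \<le> card (nbrs K y)"
  shows "card (extension K (A \<union> B)) \<le> card (extension K {})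
    + card {T \<in> extension K A. T \<inter> A \<noteq> {}} + card {T \<in> extension K B. T \<inter> B \<noteq> {}}"
  using card_extension_Un_le_sum_if_card_le[OF assms]
    card_extension_Un_le_sum_if_card_le[OF assms(1,2,4,3,6,5)]
  by (cases "card A \<le> card B") (auto simp: Un_commute)

section \<open>Union generators and the degree condition\<close>

lemma Union_mem_if_union_closed:
  assumes "union_closed F" and "{} \<in> F" and "finite S" and "S \<subseteq> F"
  shows "\<Union>S \<in> F"
  using assms(3,4)
  by (induction S rule: finite_induct) (use assms in \<open>auto simp: union_closed_def\<close>)

text \<open>A member that is not a generator has a smaller member through \<open>w\<close>; the
  descent stops because \<open>W\<close> is finite.\<close>

lemma obtain_union_generator:
  assumes "finite W" and "W \<in> F" and "w \<in> W"
  shows "\<exists>V\<in>union_generators F. w \<in> V \<and> V \<subseteq> W"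
  using assms
proof (induction W rule: finite_psubset_induct)
  case (psubset W)
  show ?case
  proof (cases "W \<in> union_generators F")
    case False
    then have "W = \<Union>{V \<in> F. V \<subset> W}"
      using psubset.prems by (auto simp: union_generators_def)
    then obtain V where "V \<in> F" "V \<subset> W" "w \<in> V" using psubset.prems by blast
    from psubset.IH[OF this(2,1,3)] show ?thesis using \<open>V \<subset> W\<close> by blast
  qed (use psubset.prems in blast)
qed

definition outer_nbrs :: "'a set set \<Rightarrow> 'a set \<Rightarrow> 'a \<Rightarrow> 'a set" where
  "outer_nbrs F U a = {x. x \<notin> U \<and> {a, x} \<in> union_generators F}"

lemma ecard_mono: "A \<subseteq> B \<Longrightarrow> ecard A \<le> ecard B"
  by (auto simp: ecard_def card_mono finite_subset)

text \<open>With \<open>A\<close> and \<open>B\<close> the outer neighbours of \<open>a\<close> and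
  \<open>b\<close>, the edge \<open>{a, b}\<close> has degree at least
  \<open>card A + card B\<close>. The edges meeting \<open>{a, x}\<close> are among
  \<open>{a, b}\<close>, the other edges from \<open>a\<close> to \<open>A\<close>, and edges from
  \<open>x\<close> that avoid \<open>{a, b}\<close>, as \<open>{b, x}\<close> is not a generator.
  Comparing degrees cancels \<open>card A\<close>.\<close>

lemma card_outer_nbrs_le_card_nbrs:
  assumes "finite F" and fin: "\<forall>W\<in>F. finite W" and ab: "a \<noteq> b"
    and simple: "is_simple_graph H" and sub: "H \<subseteq> union_generators F"
    and edges: "\<forall>V\<in>union_generators F. V \<inter> {a, b} \<noteq> {} \<and> card V = 2
      \<longrightarrow> V \<in> H \<and> degree H {a, b} \<le> degree H V"
    and x: "x \<in> outer_nbrs F {a, b} a - outer_nbrs F {a, b} b"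
  shows "card (outer_nbrs F {a, b} b) \<le> card (nbrs {V \<in> F. V \<inter> {a, b} = {}} x)"
proof -
  define A where "A = outer_nbrs F {a, b} a"
  define B where "B = outer_nbrs F {a, b} b"
  define K where "K = {V \<in> F. V \<inter> {a, b} = {}}"
  have JF: "union_generators F \<subseteq> F" by (auto simp: union_generators_def)
  have "A \<subseteq> \<Union>F" "B \<subseteq> \<Union>F" using JF by (auto simp: A_def B_def outer_nbrs_def)
  then have fAB: "finite A" "finite B" using assms(1) fin by (meson finite_Union finite_subset)+
  have fN: "finite (nbrs K x)" using assms(1) fin by (intro finite_nbrs) (auto simp: K_def)
  have xA: "x \<in> A" "x \<noteq> a" "x \<noteq> b" "{a, x} \<in> union_generators F" "{b, x} \<notin> union_generators F"
    using x by (auto simp: A_def outer_nbrs_def)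
  have edge: "{c, y} \<in> H \<and> degree H {a, b} \<le> degree H {c, y}"
    if "c \<in> {a, b}" "{c, y} \<in> union_generators F" "c \<noteq> y" for c y
    using bspec[OF edges that(2)] that by auto
  have low: "(\<lambda>y. {a, y}) ` A \<union> (\<lambda>y. {b, y}) ` B \<subseteq> {W \<in> H - {{a, b}}. W \<inter> {a, b} \<noteq> {}}"
    using edge ab by (auto simp: A_def B_def outer_nbrs_def doubleton_eq_iff)
  have "card ((\<lambda>y. {a, y}) ` A \<union> (\<lambda>y. {b, y}) ` B)
    = card ((\<lambda>y. {a, y}) ` A) + card ((\<lambda>y. {b, y}) ` B)"
    using fAB ab by (intro card_Un_disjoint) (auto simp: A_def outer_nbrs_def doubleton_eq_iff)
  also have "\<dots> = card A + card B"
    by (subst (1 2) card_image) (auto simp: inj_on_def doubleton_eq_iff)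
  finally have "enat (card A + card B) \<le> degree H {a, b}"
    using ecard_mono[OF low] fAB by (simp add: degree_def ecard_def)
  also have "\<dots> \<le> degree H {a, x}"
    using edge[of a x] xA by simp
  also have "\<dots> \<le> ecard (insert {a, b} ((\<lambda>y. {a, y}) ` (A - {x}) \<union> (\<lambda>z. {x, z}) ` nbrs K x))"
    unfolding degree_def
  proof (rule ecard_mono, rule subsetI, rule ccontr)
    fix W
    assume "W \<in> {W \<in> H - {{a, x}}. W \<inter> {a, x} \<noteq> {}}"
      and no: "W \<notin> insert {a, b} ((\<lambda>y. {a, y}) ` (A - {x}) \<union> (\<lambda>z. {x, z}) ` nbrs K x)"
    then obtain w where W: "W \<in> H" "W \<noteq> {a, x}" "w \<in> W" "w \<in> {a, x}" by blast
    have "card W = 2" using simple W by (auto simp: is_simple_graph_def)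
    then obtain z where z: "W = {w, z}" "z \<noteq> w"
      using W(3) by (auto simp: card_2_iff)
    have WJ: "W \<in> union_generators F" using W sub by auto
    show False
    proof (cases "w = a")
      case True
      then show ?thesis using z W no WJ ab by (auto simp: A_def outer_nbrs_def)
    next
      case False
      then have wx: "w = x" using W by auto
      then have "z \<noteq> a" "z \<noteq> b" using z W xA WJ by (auto simp: insert_commute)
      then have "z \<in> nbrs K x"
        using wx z WJ JF xA by (auto simp: nbrs_def K_def)
      then show ?thesis using no z wx by auto
    qed
  qed
  \<comment> \<open>The extra edge \<open>{a, b}\<close> makes up for the point \<open>x\<close>
    missing from \<open>A\<close>.\<close>
  also have "\<dots> \<le> enat (card A + card (nbrs K x))"
  proof -
    have "card (insert {a, b} ((\<lambda>y. {a, y}) ` (A - {x}) \<union> (\<lambda>z. {x, z}) ` nbrs K x))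
      \<le> Suc (card ((\<lambda>y. {a, y}) ` (A - {x})) + card ((\<lambda>z. {x, z}) ` nbrs K x))"
      using card_Un_le[of "(\<lambda>y. {a, y}) ` (A - {x})" "(\<lambda>z. {x, z}) ` nbrs K x"] fAB fN
      by (simp add: card_insert_if)
    also have "\<dots> \<le> Suc (card (A - {x}) + card (nbrs K x))"
      using fAB fN by (simp add: add_mono card_image_le)
    also have "\<dots> = card A + card (nbrs K x)"
      using card_Suc_Diff1[OF fAB(1) xA(1)] by simp
    finally show ?thesis using fAB fN by (simp add: ecard_def)
  qed
  finally show ?thesis by (simp add: B_def K_def)
qed

text \<open>The edges \<open>{a, x}\<close> with \<open>x \<in> T \<inter> A\<close> cover the
  points that \<open>K\<close> leaves uncovered, and at least one such edge exists to bring in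
  \<open>a\<close>.\<close>

lemma insert_end_mem:
  assumes F: "union_closed F" "{} \<in> F" "finite F" and "\<forall>x\<in>A. {a, x} \<in> F"
    and "T \<in> extension {V \<in> F. V \<inter> U = {}} A" and "T \<inter> A \<noteq> {}"
  shows "insert a T \<in> F"
proof -
  let ?S = "{S \<in> F. S \<inter> U = {} \<and> S \<subseteq> T} \<union> (\<lambda>x. {a, x}) ` (T \<inter> A)"
  have S: "?S \<subseteq> F" using assms(4) by auto
  have "insert a T = \<Union>?S"
    using assms(5,6) by (auto simp: extension_def uncovered_def)
  then show ?thesis
    using Union_mem_if_union_closed[OF F(1,2) finite_subset[OF S F(3)] S] by simp
qed

theorem theorem3p31:
  fixes F G :: "'a set set" and U :: "'a set"
  assumes "union_closed F"
    and "\<forall>W\<in>F. finite W"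
    and "{} \<in> F"
    and "U \<in> union_generators F"
    and "G = {V \<in> union_generators F. V \<inter> U \<noteq> {}}"
    and "card U = 2"
    and "is_graph G"
    and "\<exists>G'. is_simple_graph G' \<and> G' \<subseteq> union_generators F \<and>
           (\<forall>V\<in>G. card V = 2 \<longrightarrow> V \<in> G' \<and> degree G' V \<ge> degree G' U)"
  shows "density_property F U"
proof (cases "finite F")
  \<comment> \<open>For infinite \<open>F\<close> the right side of the density inequality is
    \<open>\<infinity>\<close>.\<close>
  case False
  then show ?thesis by (simp add: density_property_def ecard_def)
next
  case fF: True
  obtain a b where U: "U = {a, b}" and ab: "a \<noteq> b"
    using assms(6) by (auto simp: card_2_iff)
  obtain H where H: "is_simple_graph H" "H \<subseteq> union_generators F"
    and edges: "\<forall>V\<in>union_generators F. V \<inter> {a, b} \<noteq> {} \<and> card V = 2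
      \<longrightarrow> V \<in> H \<and> degree H {a, b} \<le> degree H V"
    using assms(5,8) U by auto
  have ba: "{b, a} = {a, b}" by auto
  define A where "A = outer_nbrs F {a, b} a"
  define B where "B = outer_nbrs F {a, b} b"
  define K where "K = {V \<in> F. V \<inter> {a, b} = {}}"
  have JF: "union_generators F \<subseteq> F" by (auto simp: union_generators_def)
  have "A \<subseteq> \<Union>F" "B \<subseteq> \<Union>F" using JF by (auto simp: A_def B_def outer_nbrs_def)
  then have fAB: "finite A" "finite B" using fF assms(2) by (meson finite_Union finite_subset)+
  have fK: "finite K" "\<forall>S\<in>K. finite S" using fF assms(2) by (auto simp: K_def)
  have AB: "a \<notin> A" "b \<notin> A" "a \<notin> B" "b \<notin> B" by (auto simp: A_def B_def outer_nbrs_def)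
  have dA: "\<forall>x\<in>A - B. card B \<le> card (nbrs K x)"
    using card_outer_nbrs_le_card_nbrs[OF fF assms(2) ab H edges]
    by (auto simp: A_def B_def K_def)
  have dB: "\<forall>x\<in>B - A. card A \<le> card (nbrs K x)"
    using card_outer_nbrs_le_card_nbrs[OF fF assms(2) ab[symmetric] H, unfolded ba, OF edges]
    by (auto simp: A_def B_def K_def)
  define XA where "XA = {T \<in> extension K A. T \<inter> A \<noteq> {}}"
  define XB where "XB = {T \<in> extension K B. T \<inter> B \<noteq> {}}"
  have ends: "a \<notin> T" "b \<notin> T" if "T \<in> extension K A \<union> extension K B \<union> extension K {}" for T
    using that AB by (auto simp: extension_def uncovered_def K_def)
  have count: "card (extension K (A \<union> B)) \<le> card (extension K {}) + card XA + card XB"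
    unfolding XA_def XB_def by (rule card_extension_Un_le_sum[OF fK fAB dA dB])
  \<comment> \<open>A generator inside \<open>W\<close> through an uncovered \<open>w\<close> cannot
    avoid \<open>U\<close>, since it would lie in \<open>K\<close> and cover \<open>w\<close>. Being
    of size at most two, it is an edge from \<open>a\<close> or \<open>b\<close> to
    \<open>w\<close>.\<close>
  have "(\<lambda>W. W - U) ` {W \<in> F. U \<subseteq> W} \<subseteq> extension K (A \<union> B)"
  proof clarify
    fix W assume W: "W \<in> F" "U \<subseteq> W"
    have "w \<in> A \<union> B" if w: "w \<in> uncovered K (W - U)" for w
    proof -
      have wW: "w \<in> W" "w \<notin> U" using w by (auto simp: uncovered_def)
      obtain V where V: "V \<in> union_generators F" "w \<in> V" "V \<subseteq> W"
        using obtain_union_generator[OF _ W(1) wW(1)] assms(2) W by blast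
      have "V \<inter> U \<noteq> {}"
      proof
        assume "V \<inter> U = {}"
        then have "V \<in> K" "V \<subseteq> W - U" using V JF U by (auto simp: K_def)
        then show False using w V by (auto simp: uncovered_def)
      qed
      then obtain c where c: "c \<in> V" "c \<in> U" by auto
      have "V \<in> G" using V \<open>V \<inter> U \<noteq> {}\<close> assms(5) by simp
      then have "card V = 1 \<or> card V = 2" using assms(7) by (simp add: is_graph_def)
      moreover have "c \<noteq> w" using c wW by auto
      ultimately have "V = {c, w}" using c V by (auto simp: card_1_singleton_iff card_2_iff)
      then show ?thesis
        using V c U wW by (auto simp: A_def B_def outer_nbrs_def)
    qed
    then show "W - U \<in> extension K (A \<union> B)" by (auto simp: extension_def)
  qed
  then have upper: "card {W \<in> F. U \<subseteq> W} \<le> card (extension K (A \<union> B))"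
    using fK fAB by (intro card_inj_on_le[of "\<lambda>W. W - U"] finite_extension) (auto simp: inj_on_def)
  \<comment> \<open>The three families are told apart by their traces \<open>{}\<close>,
    \<open>{a}\<close> and \<open>{b}\<close> on \<open>U\<close>, so their sizes add up.\<close>
  let ?S = "extension K {} \<union> insert a ` XA \<union> insert b ` XB"
  have K0: "extension K {} \<subseteq> F"
  proof
    fix T assume "T \<in> extension K {}"
    then have "T = \<Union>{S \<in> K. S \<subseteq> T}" by (auto simp: extension_def uncovered_def)
    moreover have "\<Union>{S \<in> K. S \<subseteq> T} \<in> F"
      using fF by (intro Union_mem_if_union_closed[OF assms(1,3)]) (auto simp: K_def)
    ultimately show "T \<in> F" by simp
  qed
  have "\<forall>x\<in>A. {a, x} \<in> F" "\<forall>x\<in>B. {b, x} \<in> F"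
    using JF by (auto simp: A_def B_def outer_nbrs_def)
  then have "insert a ` XA \<subseteq> F" "insert b ` XB \<subseteq> F"
    using insert_end_mem[OF assms(1,3) fF, of A a _ "{a, b}"]
      insert_end_mem[OF assms(1,3) fF, of B b _ "{a, b}"]
    unfolding XA_def XB_def K_def by blast+
  moreover have "\<not> U \<subseteq> T" if "T \<in> ?S" for T
    using that ends U ab by (auto simp: XA_def XB_def)
  ultimately have S: "?S \<subseteq> {W \<in> F. \<not> U \<subseteq> W}" using K0 by auto
  have fS: "finite (extension K {})" "finite XA" "finite XB"
    using finite_extension[OF fK(1)] fAB by (simp_all add: XA_def XB_def)
  have "card ?S = card (extension K {}) + card (insert a ` XA) + card (insert b ` XB)"
  proof -
    have "extension K {} \<inter> insert a ` XA = {}"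
      "(extension K {} \<union> insert a ` XA) \<inter> insert b ` XB = {}"
      using ends ab by (auto simp: XA_def XB_def)
    then show ?thesis using fS by (simp add: card_Un_disjoint)
  qed
  also have "\<dots> = card (extension K {}) + card XA + card XB"
  proof -
    have "inj_on (insert a) XA" "inj_on (insert b) XB"
      using ends by (auto simp: inj_on_def XA_def XB_def insert_ident)
    then show ?thesis by (simp add: card_image)
  qed
  finally have "card (extension K {}) + card XA + card XB \<le> card {W \<in> F. \<not> U \<subseteq> W}"
    using card_mono[OF _ S] fF by simp
  then have "2 * card {W \<in> F. U \<subseteq> W} \<le> card F"
    using upper count card_filter_split[OF fF, of "\<lambda>W. U \<subseteq> W"] by linarith
  then show ?thesis
    using fF by (simp add: density_property_def ecard_def numeral_eq_enat)
qed

end
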